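(* Let $d\ge 1$ and $n\ge 2$ be integers, let $\mathcal{D}$ be a probability distribution on $\mathbb{R}^d\times Y$, let $t>0$, let $p$ be a probability distribution (the prior) on $\mathbb{R}^d$, and let $\varepsilon\in(0,1)$. Then, with probability at least $1-\varepsilon$ over the choice of $S\sim\mathcal{D}^n$, the following holds simultaneously for all probability distributions $q$ on $\mathbb{R}^d$: $$\mathcal{L}_{\mathcal{D}}(k_q)\;\le\;\widehat{\mathcal{L}}_{S}(k_q)+\frac{2}{t}\left(\mathrm{KL}(q\|p)+\frac{t^2}{2(n-1)}+\ln\frac{n+1}{\varepsilon}\right).$$
   Context: $Y$ is a discrete (finite) label set. A sample $S=\{(x_i,y_i)\}_{i=1}^n\sim\mathcal{D}^n$ consists of $n$ i.i.d. draws from $\mathcal{D}$ on $\mathbb{R}^d\times Y$. For labels $y,y'\in Y$ put $\lambda(y,y')=1$ if $y=y'$ and $\lambda(y,y')=-1$ otherwise. For $\omega\in\mathbb{R}^d$ define $h_\omega(\delta)=\cos(\omega\cdot\delta)$ for $\delta\in\mathbb{R}^d$. For a probability distribution $q$ on $\mathbb{R}^d$ define the kernel $k_q(\delta)=\mathbb{E}_{\omega\sim q}\,h_\omega(\delta)$. The loss is $\ell(a,\lambda)=\frac{1-\lambda a}{2}$ for $a\in[-1,1]$, $\lambda\in\{-1,1\}$. The kernel alignment generalization loss is $$\mathcal{L}_{\mathcal{D}}(k_q)=\mathbb{E}_{(x,y)\sim\mathcal{D}}\,\mathbb{E}_{(x',y')\sim\mathcal{D}}\,\ell\big(k_q(x-x'),\lambda(y,y')\big),$$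 with $(x,y)$ and $(x',y')$ independent, and the empirical kernel alignment loss is $$\widehat{\mathcal{L}}_{S}(k_q)=\frac{1}{n(n-1)}\sum_{i,j=1,\,i\ne j}^{n}\ell\big(k_q(x_i-x_j),\lambda(y_i,y_j)\big).$$ $\mathrm{KL}(q\|p)=\mathbb{E}_{\omega\sim q}\ln\frac{q(\omega)}{p(\omega)}$ is the Kullback–Leibler divergence ($+\infty$ if $q$ is not absolutely continuous with respect to $p$). *)

theory Defs
  imports "HOL-Probability.Probability"
begin

definition label_sign :: "'y \<Rightarrow> 'y \<Rightarrow> real" where
  "label_sign y y' = (if y = y' then 1 else - 1)"

definition fourier_feature :: "real ^ 'd \<Rightarrow> real ^ 'd \<Rightarrow> real" where
  "fourier_feature \<omega> \<delta> = cos (\<omega> \<bullet> \<delta>)"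

definition fourier_kernel :: "(real ^ 'd) measure \<Rightarrow> real ^ 'd \<Rightarrow> real" where
  "fourier_kernel q \<delta> = (\<integral>\<omega>. fourier_feature \<omega> \<delta> \<partial>q)"

definition alignment_loss :: "real \<Rightarrow> real \<Rightarrow> real" where
  "alignment_loss a l = (1 - l * a) / 2"

definition gen_loss ::
    "((real ^ 'd) \<times> 'y) measure \<Rightarrow> (real ^ 'd \<Rightarrow> real) \<Rightarrow> real" where
  "gen_loss D k =
    (\<integral>(x, y). (\<integral>(x', y'). alignment_loss (k (x - x')) (label_sign y y') \<partial>D) \<partial>D)"

definition emp_loss ::
    "nat \<Rightarrow> (nat \<Rightarrow> (real ^ 'd) \<times> 'y) \<Rightarrow> (real ^ 'd \<Rightarrow> real) \<Rightarrow> real" where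
  "emp_loss n S k =
    1 / (real n * (real n - 1)) *
    (\<Sum>i\<in>{1..n}. \<Sum>j\<in>{1..n} - {i}.
      alignment_loss (k (fst (S i) - fst (S j))) (label_sign (snd (S i)) (snd (S j))))"

text \<open>
  The library constant \<^const>\<open>KL_divergence\<close> is real-valued, takes the reference measure
  before the measure being compared, and is meaningless when the log-density is not
  integrable. Since \<open>u * ln u\<close> is bounded below, the negative part of the log-density of a
  probability measure \<open>q\<close> with respect to a probability measure \<open>p\<close> is always
  \<open>q\<close>-integrable, so for absolutely continuous \<open>q\<close> failure of integrability means that
  the expectation is plus infinity.
\<close>
definition KL :: "'a measure \<Rightarrow> 'a measure \<Rightarrow> ereal" where
  "KL q p =
    (if absolutely_continuous p q \<and> integrable q (entropy_density (exp 1) p q)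
     then ereal (KL_divergence (exp 1) p q) else \<infinity>)"

end

theory Submission
  imports Defs
begin

text \<open>
  Both losses are linear in the kernel, so the gap at \<open>k\<^sub>q\<close> is the \<open>q\<close>-average of the gaps
  \<open>\<Delta> S \<omega>\<close> of the single features. By the Donsker-Varadhan variational formula, whose supremum is
  attained at the Gibbs measure, the bound holds for all \<open>q\<close> if and only if the single random
  variable \<open>Z S = E\<^bsub>\<omega>\<sim>p\<^esub> exp (t/2 * \<Delta> S \<omega>)\<close> is below a threshold; this equivalence is also what
  makes the event, an uncountable intersection, measurable (otherwise its measure would be 0). Changing one sample point moves the
  empirical loss by at most \<open>2/n\<close>, so McDiarmid's moment generating function bound controls the mean
  of \<open>Z\<close>, and Markov's inequality finishes the proof.
\<close>

section \<open>Bounded differences: exponential moments in the style of McDiarmid\<close>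

lemma (in prob_space) integrable_bounded:
  fixes f :: "'a \<Rightarrow> real"
  assumes "f \<in> borel_measurable M" and "\<And>x. x \<in> space M \<Longrightarrow> \<bar>f x\<bar> \<le> B"
  shows "integrable M f"
  by (rule integrable_const_bound[where B=B]) (use assms in auto)

lemma (in prob_space) abs_expectation_le:
  fixes f :: "'a \<Rightarrow> real"
  assumes [measurable]: "f \<in> borel_measurable M" and B: "\<And>x. x \<in> space M \<Longrightarrow> \<bar>f x\<bar> \<le> B"
  shows "\<bar>expectation f\<bar> \<le> B"
proof -
  have "\<bar>expectation f\<bar> \<le> expectation (\<lambda>x. \<bar>f x\<bar>)"
    by (rule integral_abs_bound)
  also have "\<dots> \<le> B"
    by (intro integral_le_const integrable_bounded[where B=B]) (use B in auto)
  finally show ?thesis .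
qed

text \<open>All values of \<open>f\<close> lie between their infimum \<open>a\<close> and supremum
  \<open>b\<close>, and the oscillation bound gives \<open>b - a \<le> c\<close>, so Hoeffding's
  lemma on that interval applies. Only the length of the interval is prescribed, because in the
  induction below its position moves with the coordinates held fixed.\<close>

lemma (in prob_space) Hoeffdings_lemma_oscillation:
  fixes f :: "'a \<Rightarrow> real"
  assumes [measurable]: "f \<in> borel_measurable M"
    and osc: "\<And>x y. x \<in> space M \<Longrightarrow> y \<in> space M \<Longrightarrow> \<bar>f x - f y\<bar> \<le> c"
    and l: "l > 0"
  shows "expectation (\<lambda>x. exp (l * (f x - expectation f))) \<le> exp (l\<^sup>2 * c\<^sup>2 / 8)"
proof -
  define a where "a = (INF x\<in>space M. f x)"
  define b where "b = (SUP x\<in>space M. f x)"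
  obtain x0 where x0: "x0 \<in> space M" using not_empty by auto
  have up: "f x \<le> f y + c" if "x \<in> space M" "y \<in> space M" for x y
    using osc[OF that] by linarith
  have bb: "bdd_below (f ` space M)" "bdd_above (f ` space M)"
    using up[OF x0] up[OF _ x0]
    by (auto intro!: bdd_belowI[where m="f x0 - c"] bdd_aboveI[where M="f x0 + c"] simp: algebra_simps)
  have ab: "f x \<in> {a..b}" if "x \<in> space M" for x
    unfolding a_def b_def using that bb by (auto intro: cINF_lower cSUP_upper)
  have "b \<le> f y + c" if "y \<in> space M" for y
    unfolding b_def using x0 up that by (auto intro!: cSUP_least)
  then have "b - c \<le> a"
    unfolding a_def using x0 by (intro cINF_greatest) (auto simp: algebra_simps)
  then have bac: "b - a \<le> c" by simp
  have ba: "0 \<le> b - a" using ab[OF x0] by simp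
  interpret interval_bounded_random_variable M f a b
    by unfold_locales (use ab in auto)
  have "ennreal (expectation (\<lambda>x. exp (l * (f x - expectation f)))) =
      (\<integral>\<^sup>+x. exp (l * (f x - expectation f)) \<partial>M)"
  proof (rule nn_integral_eq_integral[symmetric])
    show "integrable M (\<lambda>x. exp (l * (f x - expectation f)))"
      by (rule integrable_bounded[where B="exp (l * (b - expectation f))"])
         (use ab l in auto)
  qed auto
  also have "\<dots> \<le> ennreal (exp (l\<^sup>2 * (b - a)\<^sup>2 / 8))"
    by (rule Hoeffdings_lemma_nn_integral[OF l])
  finally have "expectation (\<lambda>x. exp (l * (f x - expectation f))) \<le> exp (l\<^sup>2 * (b - a)\<^sup>2 / 8)"
    by simp
  also have "\<dots> \<le> exp (l\<^sup>2 * c\<^sup>2 / 8)"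
    using power_mono[OF bac ba, of 2] by (simp add: mult_left_mono)
  finally show ?thesis .
qed

text \<open>Induction over the coordinates. Averaging out one coordinate \<open>i\<close> leaves a
  function \<open>h\<close> of the others that inherits their bounded differences. For fixed other
  coordinates, \<open>g - h\<close> is centred and oscillates by at most \<open>c i\<close>, so
  Hoeffding's lemma contributes one factor \<open>exp (l\<^sup>2 * (c i)\<^sup>2 / 8)\<close>. The
  uniform bound \<open>B\<close> secures integrability.\<close>

lemma (in product_prob_space) bounded_differences_mgf:
  fixes g :: "('i \<Rightarrow> 'a) \<Rightarrow> real" and c :: "'i \<Rightarrow> real"
  assumes J: "finite J"
    and g: "g \<in> borel_measurable (PiM J M)"
    and bdd: "\<And>x. x \<in> space (PiM J M) \<Longrightarrow> \<bar>g x\<bar> \<le> B"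
    and diff: "\<And>x i y. x \<in> space (PiM J M) \<Longrightarrow> i \<in> J \<Longrightarrow> y \<in> space (M i) \<Longrightarrow>
      \<bar>g (x(i := y)) - g x\<bar> \<le> c i"
    and l: "l > 0"
  shows "(\<integral>x. exp (l * (g x - (\<integral>x. g x \<partial>PiM J M))) \<partial>PiM J M) \<le> exp (l\<^sup>2 * (\<Sum>i\<in>J. (c i)\<^sup>2) / 8)"
  using J g bdd diff
proof (induction J arbitrary: g rule: finite_induct)
  \<comment> \<open>The product over no coordinates is a point mass, so \<open>g\<close> equals its
    mean and both sides are 1.\<close>
  case empty
  then show ?case
    by (simp add: PiM_empty lebesgue_integral_count_space_finite)
next
  case (insert i J)
  note g[measurable] = insert.prems(1)
  interpret PJ: prob_space "PiM J M" by (rule prob_space_PiM) (rule prob_space)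
  interpret PiJ: prob_space "PiM (insert i J) M" by (rule prob_space_PiM) (rule prob_space)
  \<comment> \<open>The conditional expectation of \<open>g\<close> given the coordinates in
    \<open>J\<close>.\<close>
  define h where "h x = (\<integral>y. g (x(i := y)) \<partial>M i)" for x
  have upd: "x(i := y) \<in> space (PiM (insert i J) M)" if "x \<in> space (PiM J M)" "y \<in> space (M i)" for x y
    using that by (auto simp: space_PiM PiE_def extensional_def)
  have [measurable]: "(\<lambda>y. g (x(i := y))) \<in> borel_measurable (M i)" if "x \<in> space (PiM J M)" for x
    using measurable_comp[OF measurable_component_update g, OF that \<open>i \<notin> J\<close>]
    by (simp add: comp_def fun_upd_def)
  have gB: "\<bar>g (x(i := y))\<bar> \<le> B" if "x \<in> space (PiM J M)" "y \<in> space (M i)" for x y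
    using upd[OF that] insert.prems(2) by auto
  have [measurable]: "h \<in> borel_measurable (PiM J M)"
    unfolding h_def by measurable
  have hB: "\<bar>h x\<bar> \<le> B" if "x \<in> space (PiM J M)" for x
    unfolding h_def by (rule M.abs_expectation_le) (use that gB in auto)
  \<comment> \<open>Since \<open>k \<noteq> i\<close>, the updates at \<open>k\<close> and
    \<open>i\<close> commute, so the difference of \<open>h\<close> is an average of differences of
    \<open>g\<close> at \<open>k\<close>.\<close>
  have hdiff: "\<bar>h (x(k := z)) - h x\<bar> \<le> c k"
    if x: "x \<in> space (PiM J M)" and k: "k \<in> J" and z: "z \<in> space (M k)" for x k z
  proof -
    have xk: "x(k := z) \<in> space (PiM J M)"
      using x k z by (auto simp: space_PiM PiE_def extensional_def)
    have ki: "k \<noteq> i" using k insert.hyps by auto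
    have "h (x(k := z)) - h x = (\<integral>y. g (x(k := z, i := y)) - g (x(i := y)) \<partial>M i)"
      unfolding h_def
      by (rule Bochner_Integration.integral_diff[symmetric]; rule M.integrable_bounded[where B=B])
         (use x xk gB in auto)
    moreover have "\<bar>\<integral>y. g (x(k := z, i := y)) - g (x(i := y)) \<partial>M i\<bar> \<le> c k"
    proof (rule M.abs_expectation_le)
      fix y assume y: "y \<in> space (M i)"
      show "\<bar>g (x(k := z, i := y)) - g (x(i := y))\<bar> \<le> c k"
        using insert.prems(3)[OF upd[OF x y] _ z] k
        by (simp only: fun_upd_twist[OF ki] insert_iff simp_thms)
    qed (use x xk in auto)
    ultimately show ?thesis by simp
  qed
  define E where "E = (\<integral>x. g x \<partial>PiM (insert i J) M)"
  have Eh: "E = (\<integral>x. h x \<partial>PiM J M)"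
    unfolding E_def h_def using insert.hyps
    by (intro product_integral_insert PiJ.integrable_bounded[where B=B] insert.prems) auto
  have intg: "integrable (PiM (insert i J) M) (\<lambda>x. exp (l * (g x - E)))"
  proof (rule PiJ.integrable_bounded[where B="exp (l * (B - E))"])
    fix x assume "x \<in> space (PiM (insert i J) M)"
    with insert.prems(2)[OF this] l show "\<bar>exp (l * (g x - E))\<bar> \<le> exp (l * (B - E))" by auto
  qed measurable
  have "(\<integral>x. exp (l * (g x - E)) \<partial>PiM (insert i J) M)
      = (\<integral>x. (\<integral>y. exp (l * (g (x(i := y)) - E)) \<partial>M i) \<partial>PiM J M)"
    using insert.hyps intg by (intro product_integral_insert) auto
  \<comment> \<open>Split \<open>g - E\<close> as \<open>(h - E) + (g - h)\<close>; the first
    summand is constant in the new coordinate and leaves the inner integral.\<close>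
  also have "\<dots> = (\<integral>x. exp (l * (h x - E)) * (\<integral>y. exp (l * (g (x(i := y)) - h x)) \<partial>M i) \<partial>PiM J M)"
    by (intro Bochner_Integration.integral_cong refl, subst integral_mult_right_zero[symmetric])
       (simp flip: exp_add add: algebra_simps)
  also have "\<dots> \<le> (\<integral>x. exp (l * (h x - E)) * exp (l\<^sup>2 * (c i)\<^sup>2 / 8) \<partial>PiM J M)"
  proof (rule integral_mono)
    fix x assume x: "x \<in> space (PiM J M)"
    have "(\<integral>y. exp (l * (g (x(i := y)) - h x)) \<partial>M i) \<le> exp (l\<^sup>2 * (c i)\<^sup>2 / 8)"
      unfolding h_def
    proof (rule M.Hoeffdings_lemma_oscillation[OF _ _ l])
      \<comment> \<open>The point \<open>x(i := y)\<close> is itself an update of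
        \<open>x(i := z)\<close> at \<open>i\<close>, so a single use of the difference bound gives
        the full oscillation.\<close>
      fix y z assume "y \<in> space (M i)" and z: "z \<in> space (M i)"
      then show "\<bar>g (x(i := y)) - g (x(i := z))\<bar> \<le> c i"
        using insert.prems(3)[OF upd[OF x z], of i y] by (simp only: fun_upd_upd insert_iff simp_thms)
    qed (use x in auto)
    then show "exp (l * (h x - E)) * (\<integral>y. exp (l * (g (x(i := y)) - h x)) \<partial>M i)
        \<le> exp (l * (h x - E)) * exp (l\<^sup>2 * (c i)\<^sup>2 / 8)"
      by (intro mult_left_mono) auto
  next
    have bnd: "exp (l * (h x - E)) \<le> exp (l * (B - E))" if "x \<in> space (PiM J M)" for x
      using hB[OF that] l by auto
    have bnd2: "exp (l * (g (x(i := y)) - h x)) \<le> exp (l * (2 * B))"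
      if "x \<in> space (PiM J M)" "y \<in> space (M i)" for x y
      using hB[OF that(1)] gB[OF that] l by auto
    show "integrable (PiM J M) (\<lambda>x. exp (l * (h x - E)) * exp (l\<^sup>2 * (c i)\<^sup>2 / 8))"
      by (rule integrable_mult_left, rule PJ.integrable_bounded[where B="exp (l * (B - E))"])
         (use bnd in auto)
    show "integrable (PiM J M) (\<lambda>x. exp (l * (h x - E)) * (\<integral>y. exp (l * (g (x(i := y)) - h x)) \<partial>M i))"
    proof (rule PJ.integrable_bounded[where B="exp (l * (B - E)) * exp (l * (2 * B))"])
      fix x assume x: "x \<in> space (PiM J M)"
      have "\<bar>\<integral>y. exp (l * (g (x(i := y)) - h x)) \<partial>M i\<bar> \<le> exp (l * (2 * B))"
        by (rule M.abs_expectation_le) (use x bnd2 in auto)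
      then show "\<bar>exp (l * (h x - E)) * (\<integral>y. exp (l * (g (x(i := y)) - h x)) \<partial>M i)\<bar>
          \<le> exp (l * (B - E)) * exp (l * (2 * B))"
        unfolding abs_mult using bnd[OF x] by (intro mult_mono) auto
    qed measurable
  qed
  also have "\<dots> = exp (l\<^sup>2 * (c i)\<^sup>2 / 8) * (\<integral>x. exp (l * (h x - (\<integral>x. h x \<partial>PiM J M))) \<partial>PiM J M)"
    by (simp add: Eh)
  also have "\<dots> \<le> exp (l\<^sup>2 * (c i)\<^sup>2 / 8) * exp (l\<^sup>2 * (\<Sum>i\<in>J. (c i)\<^sup>2) / 8)"
    by (intro mult_left_mono insert.IH hB hdiff) auto
  also have "\<dots> = exp (l\<^sup>2 * (\<Sum>i\<in>insert i J. (c i)\<^sup>2) / 8)"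
    using insert.hyps by (simp flip: exp_add add: algebra_simps add_divide_distrib)
  finally show ?case by (simp add: E_def)
qed

section \<open>The Donsker-Varadhan formula and its maximizer\<close>

text \<open>With \<open>r\<close> the density of \<open>q\<close> with respect to \<open>p\<close>
  and \<open>Z\<close> the \<open>p\<close>-mean of \<open>exp f\<close>, the inequality
  \<open>ln u \<le> u - 1\<close> at \<open>u = exp (f x) / r x / Z\<close> suffices, because this
  \<open>u\<close> has \<open>q\<close>-mean at most 1. If the divergence is infinite, the bound is
  trivial.\<close>

lemma Donsker_Varadhan_le:
  fixes f :: "'a \<Rightarrow> real"
  assumes p: "prob_space p" and q: "prob_space q" and sets: "sets q = sets p"
    and f[measurable]: "f \<in> borel_measurable p" and bdd: "\<And>x. \<bar>f x\<bar> \<le> B"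
  shows "ereal (\<integral>x. f x \<partial>q) \<le> KL q p + ereal (ln (\<integral>x. exp (f x) \<partial>p))"
proof (cases "absolutely_continuous p q \<and> integrable q (entropy_density (exp 1) p q)")
  case False
  then show ?thesis unfolding KL_def by (subst if_not_P) auto
next
  case True
  then have ac: "absolutely_continuous p q" and int: "integrable q (entropy_density (exp 1) p q)"
    by auto
  interpret p: prob_space p by (rule p)
  interpret q: prob_space q by (rule q)
  note [measurable_cong] = sets
  \<comment> \<open>A real-valued version of the density that is positive \<open>q\<close>-almost
    everywhere, so that its logarithm and its reciprocal can be used under \<open>q\<close>.\<close>
  obtain r where r[measurable]: "r \<in> borel_measurable p"
    and r_RN: "AE x in p. RN_deriv p q x = ennreal (r x)"
    and r_pos_q: "AE x in q. 0 < r x" and r_nn: "\<And>x. 0 \<le> r x"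
    by (rule p.real_RN_deriv[OF q.finite_measure_axioms ac sets]) blast
  have q_eq: "q = density p r"
  proof -
    have "q = density p (RN_deriv p q)"
      using p.density_RN_deriv[OF ac sets] by simp
    also have "\<dots> = density p r"
      using r_RN by (intro density_cong) auto
    finally show ?thesis .
  qed
  define Z where "Z = (\<integral>x. exp (f x) \<partial>p)"
  have int_exp: "integrable p (\<lambda>x. exp (f x))"
    using bdd by (intro p.integrable_const_bound[where B="exp B"]) (auto intro!: AE_I2 simp: abs_le_iff)
  have "exp (- B) \<le> Z"
    unfolding Z_def using bdd by (intro p.integral_ge_const int_exp) (auto simp: abs_le_iff minus_le_iff)
  then have Z: "Z > 0" using less_le_trans[OF exp_gt_zero] by blast
  have ed: "AE x in q. entropy_density (exp 1) p q x = ln (r x)"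
    using absolutely_continuous_AE[OF sets ac r_RN]
    by eventually_elim (use r_nn in \<open>simp add: entropy_density_def log_def\<close>)
  have KLeq: "KL q p = ereal (\<integral>x. ln (r x) \<partial>q)"
    using True ed by (auto simp: KL_def KL_divergence_def intro!: integral_cong_AE)
  have int_ln: "integrable q (\<lambda>x. ln (r x))"
    using int ed by (intro integrable_cong_AE_imp[OF int]) auto
  have int_f: "integrable q f"
    using bdd by (intro q.integrable_const_bound[where B=B]) auto
  \<comment> \<open>Where \<open>r x = 0\<close>, division by zero yields 0, so this integrand is 0
    there and \<open>exp (f x)\<close> elsewhere. This is why the comparison with \<open>Z\<close>
    below is an inequality.\<close>
  have int_pr: "integrable p (\<lambda>x. r x * (exp (f x) / r x))"
    by (rule Bochner_Integration.integrable_bound[OF int_exp]) auto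
  have int_r: "integrable q (\<lambda>x. exp (f x) / r x)"
    unfolding q_eq using r_nn int_pr by (subst integrable_real_density) auto
  have "(\<integral>x. exp (f x) / r x \<partial>q) = (\<integral>x. r x * (exp (f x) / r x) \<partial>p)"
    unfolding q_eq using r_nn by (subst integral_real_density) auto
  also have "\<dots> \<le> Z"
    unfolding Z_def by (intro integral_mono int_pr int_exp) auto
  finally have le_Z: "(\<integral>x. exp (f x) / r x \<partial>q) \<le> Z" .
  have "(\<integral>x. f x \<partial>q) - (\<integral>x. ln (r x) \<partial>q) - ln Z = (\<integral>x. f x - ln (r x) - ln Z \<partial>q)"
    using int_f int_ln by (simp add: q.prob_space)
  also have "\<dots> \<le> (\<integral>x. exp (f x) / r x / Z - 1 \<partial>q)"
  proof (rule integral_mono_AE)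
    show "AE x in q. f x - ln (r x) - ln Z \<le> exp (f x) / r x / Z - 1"
      using r_pos_q
    proof eventually_elim
      case (elim x)
      have "f x - ln (r x) - ln Z = ln (exp (f x) / r x / Z)"
        using elim Z by (simp add: ln_div ln_mult)
      also have "\<dots> \<le> exp (f x) / r x / Z - 1"
        using elim Z by (intro ln_le_minus_one) auto
      finally show ?case .
    qed
    show "integrable q (\<lambda>x. exp (f x) / r x / Z - 1)"
      using integrable_divide[OF int_r, of Z] by simp
  qed (use int_f int_ln in auto)
  also have "\<dots> = (\<integral>x. exp (f x) / r x \<partial>q) / Z - 1"
    using integrable_divide[OF int_r, of Z] by (simp add: q.prob_space del: divide_divide_eq_left)
  also have "\<dots> \<le> 0" using le_Z Z by simp
  finally show ?thesis by (simp add: KLeq Z_def)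
qed

text \<open>The equality case of the variational formula: the Gibbs density
  \<open>exp (f x) / Z\<close> has logarithm \<open>f x - ln Z\<close>, whose \<open>q\<close>-mean
  is the divergence. It turns a bound valid for every \<open>q\<close> into a bound on
  \<open>Z\<close>.\<close>

lemma KL_Gibbs:
  fixes f :: "'a \<Rightarrow> real"
  assumes p: "prob_space p"
    and f[measurable]: "f \<in> borel_measurable p" and bdd: "\<And>x. \<bar>f x\<bar> \<le> B"
  defines "Z \<equiv> \<integral>x. exp (f x) \<partial>p"
  defines "q \<equiv> density p (\<lambda>x. ennreal (exp (f x) / Z))"
  shows "prob_space q" and "KL q p = ereal ((\<integral>x. f x \<partial>q) - ln Z)"
proof -
  interpret p: prob_space p by (rule p)
  have int_exp: "integrable p (\<lambda>x. exp (f x))"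
    using bdd by (intro p.integrable_const_bound[where B="exp B"]) (auto intro!: AE_I2 simp: abs_le_iff)
  have "exp (- B) \<le> Z"
    unfolding Z_def using bdd by (intro p.integral_ge_const int_exp) (auto simp: abs_le_iff minus_le_iff)
  then have Z: "Z > 0" using less_le_trans[OF exp_gt_zero] by blast
  have "emeasure q (space q) = (\<integral>\<^sup>+x. ennreal (exp (f x) / Z) \<partial>p)"
    unfolding q_def by (simp add: emeasure_density cong: nn_integral_cong)
  also have "\<dots> = ennreal (\<integral>x. exp (f x) / Z \<partial>p)"
    using int_exp Z by (intro nn_integral_eq_integral) auto
  also have "\<dots> = 1" using Z by (simp add: Z_def)
  finally show q: "prob_space q" by (rule prob_spaceI)
  interpret q: prob_space q by (rule q)
  have ac: "absolutely_continuous p q"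
    unfolding q_def by (intro absolutely_continuousI_density) auto
  \<comment> \<open>The Radon-Nikodym derivative is determined only \<open>p\<close>-almost
    everywhere; absolute continuity transfers the identity to \<open>q\<close>.\<close>
  have "AE x in p. ennreal (exp (f x) / Z) = RN_deriv p q x"
    by (rule p.RN_deriv_unique) (auto simp: q_def)
  then have "AE x in q. ennreal (exp (f x) / Z) = RN_deriv p q x"
    by (rule absolutely_continuous_AE[rotated -1]) (use ac in \<open>auto simp: q_def\<close>)
  then have ed: "AE x in q. entropy_density (exp 1) p q x = f x - ln Z"
  proof eventually_elim
    case (elim x)
    show ?case
      using Z by (simp add: entropy_density_def elim[symmetric] log_def ln_div)
  qed
  have [measurable_cong]: "sets q = sets p" by (simp add: q_def)
  have int_f: "integrable q f"
    using bdd by (intro q.integrable_const_bound[where B=B]) auto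
  have "integrable q (entropy_density (exp 1) p q)"
    by (rule integrable_cong_AE_imp[where g="\<lambda>x. f x - ln Z"]) (use int_f ed in auto)
  moreover have "(\<integral>x. entropy_density (exp 1) p q x \<partial>q) = (\<integral>x. f x - ln Z \<partial>q)"
    using ed by (intro integral_cong_AE) auto
  ultimately show "KL q p = ereal ((\<integral>x. f x \<partial>q) - ln Z)"
    using ac int_f by (simp add: KL_def KL_divergence_def q.prob_space)
qed

text \<open>Two different coordinates are independent: the cylinder formula factorizes on
  rectangles, and these determine the product of sigma-finite measures. It supplies the mean of each
  off-diagonal term of the empirical loss.\<close>

lemma (in product_prob_space) distr_PiM_pair:
  assumes "i \<in> I" "j \<in> I" "i \<noteq> j"
  shows "distr (PiM I M) (M i \<Otimes>\<^sub>M M j) (\<lambda>x. (x i, x j)) = M i \<Otimes>\<^sub>M M j"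
proof (rule pair_measure_eqI[symmetric])
  fix A B assume A: "A \<in> sets (M i)" and B: "B \<in> sets (M j)"
  have "emeasure (distr (PiM I M) (M i \<Otimes>\<^sub>M M j) (\<lambda>x. (x i, x j))) (A \<times> B)
      = emeasure (PiM I M) {x \<in> space (PiM I M). \<forall>k\<in>{i, j}. x k \<in> (if k = i then A else B)}"
    using A B assms by (subst emeasure_distr) (auto intro!: arg_cong[where f="emeasure (PiM I M)"])
  also have "\<dots> = (\<Prod>k\<in>{i, j}. emeasure (M k) (if k = i then A else B))"
    using A B assms by (intro emeasure_PiM_Collect) auto
  also have "\<dots> = emeasure (M i) A * emeasure (M j) B"
    using assms by simp
  finally show "emeasure (M i) A * emeasure (M j) B
      = emeasure (distr (PiM I M) (M i \<Otimes>\<^sub>M M j) (\<lambda>x. (x i, x j))) (A \<times> B)" ..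
qed (auto intro: M.sigma_finite_measure_axioms)

section \<open>Bounds and bounded differences of the losses\<close>

lemma alignment_loss_bounds:
  assumes "\<bar>a\<bar> \<le> 1"
  shows "0 \<le> alignment_loss a (label_sign y y')" "alignment_loss a (label_sign y y') \<le> 1"
  using assms by (auto simp: alignment_loss_def label_sign_def)

lemma abs_fourier_feature_le: "\<bar>fourier_feature \<omega> \<delta>\<bar> \<le> 1"
  by (simp add: fourier_feature_def)

lemma emp_loss_bounds:
  assumes "n \<ge> 2" and k: "\<And>\<delta>. \<bar>k \<delta>\<bar> \<le> 1"
  shows "0 \<le> emp_loss n S k" "emp_loss n S k \<le> 1"
proof -
  have pos: "real n * (real n - 1) > 0" using assms(1) by simp
  show "0 \<le> emp_loss n S k"
    unfolding emp_loss_def using pos alignment_loss_bounds[OF k]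
    by (intro mult_nonneg_nonneg sum_nonneg) auto
  have "(\<Sum>i\<in>{1..n}. \<Sum>j\<in>{1..n} - {i}.
      alignment_loss (k (fst (S i) - fst (S j))) (label_sign (snd (S i)) (snd (S j))))
    \<le> (\<Sum>i\<in>{1..n}. \<Sum>j\<in>{1..n} - {i}. 1)"
    by (intro sum_mono alignment_loss_bounds k)
  also have "\<dots> = real n * (real n - 1)" using assms(1) by (simp add: of_nat_diff)
  finally show "emp_loss n S k \<le> 1"
    unfolding emp_loss_def using pos by (simp add: field_simps)
qed

text \<open>Exactly \<open>2 * (n - 1)\<close> of the \<open>n * (n - 1)\<close> ordered pairs
  contain the index \<open>a\<close>, and each of their terms moves by at most 1 because the loss
  lies between 0 and 1.\<close>

lemma emp_loss_bounded_difference: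
  assumes "n \<ge> 2" and k: "\<And>\<delta>. \<bar>k \<delta>\<bar> \<le> 1" and a: "a \<in> {1..n}"
  shows "\<bar>emp_loss n (S(a := z)) k - emp_loss n S k\<bar> \<le> 2 / real n"
proof -
  define h where "h S i j = alignment_loss (k (fst (S i) - fst (S j))) (label_sign (snd (S i)) (snd (S j)))"
    for S :: "nat \<Rightarrow> (real ^ 'a) \<times> 'b" and i j
  \<comment> \<open>Indicator of the changed index: for \<open>i \<noteq> j\<close>, the sum
    \<open>\<delta> i + \<delta> j\<close> is 1 if the pair contains \<open>a\<close> and 0
    otherwise, so summing it counts the affected pairs.\<close>
  define \<delta> :: "nat \<Rightarrow> real" where "\<delta> i = (if i = a then 1 else 0)" for i
  have pos: "real n * (real n - 1) > 0" using assms(1) by simp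
  have h: "\<bar>h (S(a := z)) i j - h S i j\<bar> \<le> \<delta> i + \<delta> j" for i j
  proof (cases "i = a \<or> j = a")
    case False
    then show ?thesis by (simp add: h_def \<delta>_def)
  next
    case True
    have "0 \<le> h T i j" "h T i j \<le> 1" for T
      unfolding h_def by (intro alignment_loss_bounds k)+
    from this[of S] this[of "S(a := z)"] have "\<bar>h (S(a := z)) i j - h S i j\<bar> \<le> 1" by auto
    with True show ?thesis by (auto simp: \<delta>_def)
  qed
  have "\<bar>\<Sum>i\<in>{1..n}. \<Sum>j\<in>{1..n} - {i}. h (S(a := z)) i j - h S i j\<bar>
      \<le> (\<Sum>i\<in>{1..n}. \<Sum>j\<in>{1..n} - {i}. \<delta> i + \<delta> j)"
    by (intro order_trans[OF sum_abs] sum_mono h)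
  also have "\<dots> = (\<Sum>i\<in>{1..n}. (real n - 1) * \<delta> i + (1 - \<delta> i))"
  proof (rule sum.cong[OF refl])
    fix i assume i: "i \<in> {1..n}"
    have "(\<Sum>j\<in>{1..n}. \<delta> j) = 1" using a by (simp add: \<delta>_def)
    then have "(\<Sum>j\<in>{1..n} - {i}. \<delta> j) = 1 - \<delta> i"
      using i by (simp add: sum_diff1)
    then show "(\<Sum>j\<in>{1..n} - {i}. \<delta> i + \<delta> j) = (real n - 1) * \<delta> i + (1 - \<delta> i)"
      using i assms(1) by (simp add: sum.distrib of_nat_diff)
  qed
  also have "\<dots> = 2 * (real n - 1)"
    using a by (simp add: sum.distrib sum_subtractf sum_distrib_left[symmetric] \<delta>_def)
  finally have "\<bar>\<Sum>i\<in>{1..n}. \<Sum>j\<in>{1..n} - {i}. h (S(a := z)) i j - h S i j\<bar> \<le> 2 * (real n - 1)" .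
  moreover have "emp_loss n (S(a := z)) k - emp_loss n S k =
      (\<Sum>i\<in>{1..n}. \<Sum>j\<in>{1..n} - {i}. h (S(a := z)) i j - h S i j) / (real n * (real n - 1))"
    unfolding emp_loss_def h_def[symmetric] by (simp add: sum_subtractf diff_divide_distrib)
  ultimately have "\<bar>emp_loss n (S(a := z)) k - emp_loss n S k\<bar> \<le> 2 * (real n - 1) / (real n * (real n - 1))"
    using pos by (simp add: divide_right_mono)
  also have "\<dots> = 2 / real n"
    by (rule mult_divide_mult_cancel_right) (use assms(1) in auto)
  finally show ?thesis .
qed

section \<open>Measurability, and linearity of the empirical loss in the kernel\<close>

lemma measurable_label_sign[measurable]:
  fixes f g :: "'a \<Rightarrow> 'y::finite"
  assumes [measurable]: "f \<in> M \<rightarrow>\<^sub>M count_space UNIV" "g \<in> M \<rightarrow>\<^sub>M count_space UNIV"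
  shows "(\<lambda>x. label_sign (f x) (g x)) \<in> borel_measurable M"
  unfolding label_sign_def by measurable

lemma measurable_fourier_feature[measurable]:
  assumes [measurable]: "f \<in> borel_measurable M" "g \<in> borel_measurable M"
  shows "(\<lambda>x. fourier_feature (f x) (g x)) \<in> borel_measurable M"
  unfolding fourier_feature_def by measurable

lemma measurable_alignment_loss[measurable]:
  assumes [measurable]: "f \<in> borel_measurable M" "g \<in> borel_measurable M"
  shows "(\<lambda>x. alignment_loss (f x) (g x)) \<in> borel_measurable M"
  unfolding alignment_loss_def by measurable

text \<open>The loss is affine in its first argument, so it commutes with averaging over a
  probability measure.\<close>

lemma integral_alignment_loss_fourier_feature:
  assumes q: "prob_space q" and [measurable_cong]: "sets q = sets borel"
  shows "(\<integral>\<omega>. alignment_loss (fourier_feature \<omega> \<delta>) l \<partial>q) = alignment_loss (fourier_kernel q \<delta>) l"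
proof -
  interpret q: prob_space q by (rule q)
  have "integrable q (\<lambda>\<omega>. fourier_feature \<omega> \<delta>)"
    by (rule q.integrable_const_bound[where B=1]) (auto simp: abs_fourier_feature_le)
  then show ?thesis
    unfolding alignment_loss_def fourier_kernel_def by (simp add: q.prob_space)
qed

lemma emp_loss_fourier_kernel:
  assumes q: "prob_space q" and [measurable_cong]: "sets q = sets borel"
  shows "emp_loss n S (fourier_kernel q) = (\<integral>\<omega>. emp_loss n S (fourier_feature \<omega>) \<partial>q)"
proof -
  interpret q: prob_space q by (rule q)
  have "integrable q (\<lambda>\<omega>. alignment_loss (fourier_feature \<omega> \<delta>) (label_sign y y'))" for \<delta> and y y' :: 'b
    by (rule q.integrable_const_bound[where B=1])
       (auto simp: alignment_loss_bounds abs_fourier_feature_le)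
  then show ?thesis
    unfolding emp_loss_def by (simp add: integral_alignment_loss_fourier_feature[OF assms, symmetric])
qed

section \<open>The generalization loss as a mean\<close>

context
  fixes D :: "((real ^ 'd) \<times> 'y::finite) measure"
  assumes prob_D: "prob_space D"
    and sets_D[measurable_cong]: "sets D = sets (borel \<Otimes>\<^sub>M count_space UNIV)"
begin

interpretation D: prob_space D by (rule prob_D)
interpretation DD: pair_prob_space D D ..

text \<open>Fubini for a bounded integrand. The form over the product measure is the one to which a
  further exchange of integrals and a change of variables apply.\<close>

lemma gen_loss_eq_integral_pair:
  assumes [measurable]: "k \<in> borel_measurable borel" and k: "\<And>\<delta>. \<bar>k \<delta>\<bar> \<le> 1"
  shows "gen_loss D k =
    (\<integral>z. alignment_loss (k (fst (fst z) - fst (snd z))) (label_sign (snd (fst z)) (snd (snd z))) \<partial>(D \<Otimes>\<^sub>M D))"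
proof -
  have "integrable (D \<Otimes>\<^sub>M D) (\<lambda>z. alignment_loss (k (fst (fst z) - fst (snd z))) (label_sign (snd (fst z)) (snd (snd z))))"
    by (rule DD.integrable_const_bound[where B=1]) (auto simp: alignment_loss_bounds k)
  from DD.integral_fst'[OF this] show ?thesis
    by (simp add: gen_loss_def case_prod_unfold)
qed

lemma measurable_gen_loss_fourier_feature[measurable]:
  "(\<lambda>\<omega>. gen_loss D (fourier_feature \<omega>)) \<in> borel_measurable borel"
  unfolding gen_loss_def case_prod_beta by measurable

lemma gen_loss_fourier_feature_bounds:
  "\<bar>gen_loss D (fourier_feature \<omega>)\<bar> \<le> 1"
proof -
  let ?h = "\<lambda>z. alignment_loss (fourier_feature \<omega> (fst (fst z) - fst (snd z))) (label_sign (snd (fst z)) (snd (snd z)))"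
  have i: "integrable (D \<Otimes>\<^sub>M D) ?h"
    by (rule DD.integrable_const_bound[where B=1]) (auto simp: alignment_loss_bounds abs_fourier_feature_le)
  have "gen_loss D (fourier_feature \<omega>) = integral\<^sup>L (D \<Otimes>\<^sub>M D) ?h"
    by (rule gen_loss_eq_integral_pair) (auto simp: abs_fourier_feature_le)
  moreover have "0 \<le> integral\<^sup>L (D \<Otimes>\<^sub>M D) ?h" "integral\<^sup>L (D \<Otimes>\<^sub>M D) ?h \<le> 1"
    using i by (auto intro!: DD.integral_ge_const DD.integral_le_const AE_I2
        alignment_loss_bounds abs_fourier_feature_le)
  ultimately show ?thesis by simp
qed

text \<open>The kernel is an average of features and the loss is affine, so exchanging the average
  over \<open>q\<close> with that over pairs of data points gives the claim.\<close>

lemma gen_loss_fourier_kernel: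
  assumes q: "prob_space q" and sets_q[measurable_cong]: "sets q = sets borel"
  shows "gen_loss D (fourier_kernel q) = (\<integral>\<omega>. gen_loss D (fourier_feature \<omega>) \<partial>q)"
proof -
  interpret q: prob_space q by (rule q)
  interpret P: pair_prob_space q "D \<Otimes>\<^sub>M D" ..
  let ?h = "\<lambda>\<omega> z. alignment_loss (fourier_feature \<omega> (fst (fst z) - fst (snd z))) (label_sign (snd (fst z)) (snd (snd z)))"
  have [measurable]: "fourier_kernel q \<in> borel_measurable borel"
    unfolding fourier_kernel_def[abs_def] by measurable
  have "\<bar>fourier_kernel q \<delta>\<bar> \<le> 1" for \<delta>
  proof -
    have i: "integrable q (\<lambda>\<omega>. fourier_feature \<omega> \<delta>)"
      by (rule q.integrable_const_bound[where B=1]) (auto simp: abs_fourier_feature_le)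
    have "fourier_kernel q \<delta> \<le> 1" "-1 \<le> fourier_kernel q \<delta>"
      unfolding fourier_kernel_def using abs_fourier_feature_le[of _ \<delta>] i
      by (auto intro!: q.integral_ge_const q.integral_le_const AE_I2 simp: abs_le_iff minus_le_iff)
    then show ?thesis by simp
  qed
  then have "gen_loss D (fourier_kernel q) = (\<integral>z. (\<integral>\<omega>. ?h \<omega> z \<partial>q) \<partial>(D \<Otimes>\<^sub>M D))"
    by (simp add: gen_loss_eq_integral_pair integral_alignment_loss_fourier_feature[OF assms])
  also have "\<dots> = (\<integral>\<omega>. (\<integral>z. ?h \<omega> z \<partial>(D \<Otimes>\<^sub>M D)) \<partial>q)"
    by (rule P.Fubini_integral, rule P.integrable_const_bound[where B=1])
       (auto simp: alignment_loss_bounds abs_fourier_feature_le)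
  also have "\<dots> = (\<integral>\<omega>. gen_loss D (fourier_feature \<omega>) \<partial>q)"
    by (intro Bochner_Integration.integral_cong refl gen_loss_eq_integral_pair[symmetric])
       (auto simp: abs_fourier_feature_le)
  finally show ?thesis .
qed

text \<open>Joint measurability in sample and frequency is what Fubini over both requires
  later.\<close>

lemma measurable_emp_loss_pair[measurable]:
  "(\<lambda>x. emp_loss n (fst x) (fourier_feature (snd x)))
     \<in> borel_measurable ((\<Pi>\<^sub>M i\<in>{1..n}. D) \<Otimes>\<^sub>M borel)"
  unfolding emp_loss_def by measurable

text \<open>The empirical loss is unbiased: with the diagonal left out, each of the
  \<open>n * (n - 1)\<close> terms sees two independent draws from \<open>D\<close> and has mean
  \<open>gen_loss D k\<close>.\<close>

lemma expectation_emp_loss: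
  assumes n: "n \<ge> 2" and [measurable]: "k \<in> borel_measurable borel" and k: "\<And>\<delta>. \<bar>k \<delta>\<bar> \<le> 1"
  shows "(\<integral>S. emp_loss n S k \<partial>(\<Pi>\<^sub>M i\<in>{1..n}. D)) = gen_loss D k"
proof -
  interpret P: product_prob_space "\<lambda>_. D" "{1..n}"
    by unfold_locales
  let ?P = "\<Pi>\<^sub>M i\<in>{1..n}. D"
  let ?h = "\<lambda>z. alignment_loss (k (fst (fst z) - fst (snd z))) (label_sign (snd (fst z)) (snd (snd z)))"
  have int: "integrable ?P (\<lambda>S. alignment_loss (k (fst (S i) - fst (S j))) (label_sign (snd (S i)) (snd (S j))))"
    if "i \<in> {1..n}" "j \<in> {1..n}" for i j
    by (rule P.P.integrable_const_bound[where B=1]) (use that in \<open>auto simp: alignment_loss_bounds k\<close>)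
  have eq: "(\<integral>S. alignment_loss (k (fst (S i) - fst (S j))) (label_sign (snd (S i)) (snd (S j))) \<partial>?P) = gen_loss D k"
    if "i \<in> {1..n}" "j \<in> {1..n} - {i}" for i j
  proof -
    have "gen_loss D k = (\<integral>z. ?h z \<partial>distr ?P (D \<Otimes>\<^sub>M D) (\<lambda>x. (x i, x j)))"
      using that by (subst P.distr_PiM_pair) (auto simp: gen_loss_eq_integral_pair k)
    also have "\<dots> = (\<integral>S. ?h (S i, S j) \<partial>?P)"
      using that by (subst integral_distr) auto
    finally show ?thesis by simp
  qed
  have row: "(\<integral>S. (\<Sum>j\<in>{1..n} - {i}. alignment_loss (k (fst (S i) - fst (S j)))
        (label_sign (snd (S i)) (snd (S j)))) \<partial>?P) = (\<Sum>j\<in>{1..n} - {i}. gen_loss D k)"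
    if "i \<in> {1..n}" for i
  proof (subst Bochner_Integration.integral_sum)
    show "(\<Sum>j\<in>{1..n} - {i}. \<integral>S. alignment_loss (k (fst (S i) - fst (S j)))
        (label_sign (snd (S i)) (snd (S j))) \<partial>?P) = (\<Sum>j\<in>{1..n} - {i}. gen_loss D k)"
      using that by (rule sum.cong[OF refl eq])
  qed (use that in \<open>simp add: int del: One_nat_def\<close>)
  have "(\<integral>S. emp_loss n S k \<partial>?P) = 1 / (real n * (real n - 1)) * (\<Sum>i\<in>{1..n}. \<Sum>j\<in>{1..n} - {i}. gen_loss D k)"
    unfolding emp_loss_def integral_mult_right_zero
    by (subst Bochner_Integration.integral_sum, intro Bochner_Integration.integrable_sum int)
       (auto intro!: arg_cong[where f="(*) _"] sum.cong row simp del: sum_constant One_nat_def)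
  also have "\<dots> = gen_loss D k"
    using n by (simp add: of_nat_diff)
  finally show ?thesis .
qed

end

section \<open>Exponential moment of the gap for a fixed kernel\<close>

text \<open>By unbiasedness the gap is the negated empirical loss minus its mean. Differences of
  \<open>2 / n\<close> in each of \<open>n\<close> coordinates have squares summing to
  \<open>4 / n\<close>, which divided by 8 gives \<open>1 / (2 * n)\<close>.\<close>

lemma exp_generalization_gap_le:
  fixes D :: "((real ^ 'd) \<times> 'y::finite) measure"
  assumes prob_D: "prob_space D" and sets_D[measurable_cong]: "sets D = sets (borel \<Otimes>\<^sub>M count_space UNIV)"
    and n: "n \<ge> 2" and [measurable]: "k \<in> borel_measurable borel" and k: "\<And>\<delta>. \<bar>k \<delta>\<bar> \<le> 1" and l: "l > 0"
  shows "(\<integral>S. exp (l * (gen_loss D k - emp_loss n S k)) \<partial>(\<Pi>\<^sub>M i\<in>{1..n}. D)) \<le> exp (l\<^sup>2 / (2 * real n))"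
proof -
  interpret D: prob_space D by (rule prob_D)
  interpret P: product_prob_space "\<lambda>_. D" "{1..n}"
    by unfold_locales
  let ?P = "\<Pi>\<^sub>M i\<in>{1..n}. D"
  have "(\<integral>S. exp (l * (- emp_loss n S k - (\<integral>S. - emp_loss n S k \<partial>?P))) \<partial>?P)
      \<le> exp (l\<^sup>2 * (\<Sum>i\<in>{1..n}. (2 / real n)\<^sup>2) / 8)"
  proof (rule P.bounded_differences_mgf[where B=1])
    show "(\<lambda>S. - emp_loss n S k) \<in> borel_measurable ?P"
      unfolding emp_loss_def by measurable
    show "\<bar>- emp_loss n S k\<bar> \<le> 1" for S
      using emp_loss_bounds[OF n k, of S] by simp
    show "\<bar>- emp_loss n (S(i := z)) k - - emp_loss n S k\<bar> \<le> 2 / real n" if "i \<in> {1..n}" for S i z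
      using emp_loss_bounded_difference[OF n k that, of S z] by (simp add: abs_minus_commute)
  qed (use l in auto)
  also have "l\<^sup>2 * (\<Sum>i\<in>{1..n}. (2 / real n)\<^sup>2) / 8 = l\<^sup>2 / (2 * real n)"
    using n by (simp add: power2_eq_square field_simps)
  finally show ?thesis
    using expectation_emp_loss[OF prob_D sets_D n _ k] by simp
qed

section \<open>The bound for all frequency distributions at once\<close>

theorem corollary2:
  fixes D :: "((real ^ 'd) \<times> 'y::finite) measure"
    and p :: "(real ^ 'd) measure"
    and n :: nat and t \<epsilon> :: real
  assumes "n \<ge> 2"
    and "prob_space D" and "sets D = sets (borel \<Otimes>\<^sub>M count_space UNIV)"
    and "t > 0"
    and "prob_space p" and "sets p = sets borel"
    and "0 < \<epsilon>" and "\<epsilon> < 1"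
  shows "measure (\<Pi>\<^sub>M i\<in>{1..n}. D)
    {S \<in> space (\<Pi>\<^sub>M i\<in>{1..n}. D).
      \<forall>q :: (real ^ 'd) measure. prob_space q \<and> sets q = sets borel \<longrightarrow>
        ereal (gen_loss D (fourier_kernel q)) \<le>
          ereal (emp_loss n S (fourier_kernel q)) +
          ereal (2 / t) *
            (KL q p + ereal (t\<^sup>2 / (2 * (real n - 1))) + ereal (ln ((real n + 1) / \<epsilon>)))}
    \<ge> 1 - \<epsilon>"
proof -
  note [measurable_cong] = assms(3,6)
  interpret D: prob_space D by (rule assms)
  interpret p: prob_space p by (rule assms)
  let ?P = "\<Pi>\<^sub>M i\<in>{1..n}. D"
  interpret P: prob_space ?P by (rule prob_space_PiM) (rule assms)
  interpret Pp: pair_prob_space ?P p ..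
  define \<Delta> where "\<Delta> S \<omega> = gen_loss D (fourier_feature \<omega>) - emp_loss n S (fourier_feature \<omega>)"
    for S :: "nat \<Rightarrow> (real ^ 'd) \<times> 'y" and \<omega>
  \<comment> \<open>The factor \<open>t / 2\<close> is the inverse of the \<open>2 / t\<close> in
    front of the bracket, so the claimed bound becomes a comparison of the \<open>q\<close>-mean of
    \<open>f S\<close> with \<open>KL q p + b\<close>.\<close>
  define f where "f S \<omega> = t / 2 * \<Delta> S \<omega>" for S \<omega>
  define Z where "Z S = (\<integral>\<omega>. exp (f S \<omega>) \<partial>p)" for S
  define b where "b = t\<^sup>2 / (2 * (real n - 1)) + ln ((real n + 1) / \<epsilon>)"
  note [measurable] = measurable_gen_loss_fourier_feature[OF assms(2,3)]
    measurable_emp_loss_pair[OF assms(2,3), of n]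
  have f_pair[measurable]: "case_prod f \<in> borel_measurable (?P \<Otimes>\<^sub>M p)"
    unfolding f_def \<Delta>_def case_prod_unfold by measurable
  have f_meas[measurable]: "f S \<in> borel_measurable borel" for S
    unfolding f_def \<Delta>_def emp_loss_def by measurable
  have emp_bounds: "0 \<le> emp_loss n S (fourier_feature \<omega>)" "emp_loss n S (fourier_feature \<omega>) \<le> 1"
    for S :: "nat \<Rightarrow> (real ^ 'd) \<times> 'y" and \<omega>
    by (rule emp_loss_bounds[OF assms(1)], rule abs_fourier_feature_le)+
  have f_bound: "\<bar>f S \<omega>\<bar> \<le> t" for S \<omega>
  proof -
    have "\<bar>\<Delta> S \<omega>\<bar> \<le> 2"
      using gen_loss_fourier_feature_bounds[OF assms(2,3), of \<omega>]
        emp_bounds[of S \<omega>]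
      unfolding \<Delta>_def by linarith
    then have "t / 2 * \<bar>\<Delta> S \<omega>\<bar> \<le> t / 2 * 2"
      using assms(4) by (intro mult_left_mono) auto
    then show ?thesis
      using assms(4) by (simp add: f_def abs_mult)
  qed
  have Z_pos: "Z S > 0" for S
  proof -
    have "exp (- t) \<le> Z S"
      unfolding Z_def using f_bound[of S]
      by (intro p.integral_ge_const p.integrable_const_bound[where B="exp t"] AE_I2)
         (auto simp: abs_le_iff minus_le_iff)
    then show ?thesis using less_le_trans[OF exp_gt_zero] by blast
  qed
  have gap: "gen_loss D (fourier_kernel q) - emp_loss n S (fourier_kernel q) = 2 / t * (\<integral>\<omega>. f S \<omega> \<partial>q)"
    if q: "prob_space q" and sq[measurable_cong]: "sets q = sets borel" for q S
  proof -
    interpret q: prob_space q by (rule q)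
    have "integrable q (\<lambda>\<omega>. gen_loss D (fourier_feature \<omega>))"
      using gen_loss_fourier_feature_bounds[OF assms(2,3)]
      by (intro q.integrable_const_bound[where B=1]) auto
    moreover have "integrable q (\<lambda>\<omega>. emp_loss n S (fourier_feature \<omega>))"
    proof (rule q.integrable_const_bound[where B=1])
      show "(\<lambda>\<omega>. emp_loss n S (fourier_feature \<omega>)) \<in> borel_measurable q"
        unfolding emp_loss_def by measurable
    qed (use emp_bounds[of S] in auto)
    ultimately show ?thesis
      using assms(4)
      by (simp add: f_def \<Delta>_def gen_loss_fourier_kernel[OF assms(2,3) q sq] emp_loss_fourier_kernel[OF q sq])
  qed
  have good_iff: "(\<forall>q :: (real ^ 'd) measure. prob_space q \<and> sets q = sets borel \<longrightarrow>
        ereal (gen_loss D (fourier_kernel q)) \<le> ereal (emp_loss n S (fourier_kernel q)) +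
          ereal (2 / t) * (KL q p + ereal (t\<^sup>2 / (2 * (real n - 1))) + ereal (ln ((real n + 1) / \<epsilon>))))
      \<longleftrightarrow> Z S \<le> exp b" (is "(\<forall>q. ?Q q \<longrightarrow> ?B q) \<longleftrightarrow> _") for S
  proof -
    \<comment> \<open>For real divergence this is rearrangement and cancellation of
      \<open>2 / t\<close>; for infinite divergence both sides hold; minus infinity is excluded by
      the definition of \<open>KL\<close>.\<close>
    have B_iff: "?B q \<longleftrightarrow> ereal (\<integral>\<omega>. f S \<omega> \<partial>q) \<le> KL q p + ereal b" if "?Q q" for q
    proof (cases "KL q p")
      case (real r)
      have "gen_loss D (fourier_kernel q) \<le> emp_loss n S (fourier_kernel q) + 2 / t * (r + b)
        \<longleftrightarrow> 2 / t * (\<integral>\<omega>. f S \<omega> \<partial>q) \<le> 2 / t * (r + b)"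
        using gap[of q S] that by linarith
      also have "\<dots> \<longleftrightarrow> (\<integral>\<omega>. f S \<omega> \<partial>q) \<le> r + b"
        using assms(4) by (intro mult_le_cancel_left_pos) simp
      finally show ?thesis by (simp add: real b_def add.assoc)
    next
      case PInf
      then show ?thesis using assms(4) by simp
    next
      case MInf
      then show ?thesis by (simp add: KL_def split: if_splits)
    qed
    show ?thesis
    proof
      assume ZS: "Z S \<le> exp b"
      then have lnZ: "ln (Z S) \<le> b" using Z_pos[of S] ln_le_cancel_iff[of "Z S" "exp b"] by simp
      show "\<forall>q. ?Q q \<longrightarrow> ?B q"
      proof (intro allI impI)
        fix q assume q: "?Q q"
        have "ereal (\<integral>\<omega>. f S \<omega> \<partial>q) \<le> KL q p + ereal (ln (Z S))"
          unfolding Z_def using q assms(5,6) f_bound by (intro Donsker_Varadhan_le) auto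
        also have "\<dots> \<le> KL q p + ereal b"
          using lnZ by (intro add_left_mono) simp
        finally show "?B q" using B_iff[OF q] by simp
      qed
    next
      assume all: "\<forall>q. ?Q q \<longrightarrow> ?B q"
      \<comment> \<open>The Gibbs measure is the worst case: there the mean of \<open>f S\<close>
        exceeds the divergence by exactly \<open>ln (Z S)\<close>, so the assumed bound reads
        \<open>ln (Z S) \<le> b\<close>.\<close>
      define q where "q = density p (\<lambda>\<omega>. ennreal (exp (f S \<omega>) / Z S))"
      have q: "?Q q" and KL: "KL q p = ereal ((\<integral>\<omega>. f S \<omega> \<partial>q) - ln (Z S))"
        using KL_Gibbs[OF assms(5), of "f S" t] f_bound[of S] assms(6) by (auto simp: q_def Z_def)
      have "?B q" using all q by blast
      then have "ln (Z S) \<le> b" using B_iff[OF q] by (simp add: KL)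
      then show "Z S \<le> exp b" using Z_pos[of S] ln_le_cancel_iff[of "Z S" "exp b"] by simp
    qed
  qed
  have int_pair: "integrable (?P \<Otimes>\<^sub>M p) (\<lambda>(S, \<omega>). exp (f S \<omega>))"
  proof (rule Pp.integrable_const_bound[where B="exp t"])
    show "AE x in ?P \<Otimes>\<^sub>M p. norm (case x of (S, \<omega>) \<Rightarrow> exp (f S \<omega>)) \<le> exp t"
      using f_bound by (intro AE_I2) (simp add: case_prod_unfold abs_le_iff)
    show "(\<lambda>(S, \<omega>). exp (f S \<omega>)) \<in> borel_measurable (?P \<Otimes>\<^sub>M p)"
      using measurable_compose[OF f_pair borel_measurable_exp] by (simp add: case_prod_unfold)
  qed
  have Z_int: "integrable ?P Z"
    using Pp.integrable_fst'[OF int_pair] by (simp add: Z_def[abs_def])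
  \<comment> \<open>The prior \<open>p\<close> does not depend on the sample, so the integrals may
    be exchanged and it is enough to bound the moment for each fixed frequency.\<close>
  have "(\<integral>S. Z S \<partial>?P) = (\<integral>\<omega>. (\<integral>S. exp (f S \<omega>) \<partial>?P) \<partial>p)"
    unfolding Z_def using Pp.Fubini_integral[OF int_pair] by simp
  also have "\<dots> \<le> exp (t\<^sup>2 / (2 * (real n - 1)))"
  proof (rule p.integral_le_const)
    show "integrable p (\<lambda>\<omega>. \<integral>S. exp (f S \<omega>) \<partial>?P)"
      using Pp.integrable_snd[OF int_pair] by simp
    have "(\<integral>S. exp (f S \<omega>) \<partial>?P) \<le> exp (t\<^sup>2 / (2 * (real n - 1)))" for \<omega>
    proof -
      have "(\<integral>S. exp (f S \<omega>) \<partial>?P) \<le> exp ((t / 2)\<^sup>2 / (2 * real n))"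
        unfolding f_def \<Delta>_def
        by (rule exp_generalization_gap_le[OF assms(2,3,1)]) (use assms(4) in \<open>auto simp: abs_fourier_feature_le\<close>)
      \<comment> \<open>The left side is \<open>t\<^sup>2 / (8 * n)\<close>, which lies below the
        target in both numerator and denominator.\<close>
      also have "(t / 2)\<^sup>2 / (2 * real n) \<le> t\<^sup>2 / (2 * (real n - 1))"
        using assms(1) by (intro frac_le) (auto simp: power_divide)
      finally show ?thesis by simp
    qed
    then show "AE \<omega> in p. (\<integral>S. exp (f S \<omega>) \<partial>?P) \<le> exp (t\<^sup>2 / (2 * (real n - 1)))" by simp
  qed
  finally have EZ: "(\<integral>S. Z S \<partial>?P) \<le> exp (t\<^sup>2 / (2 * (real n - 1)))" .
  have [measurable]: "Z \<in> borel_measurable ?P" using Z_int by auto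
  \<comment> \<open>Markov's inequality speaks of the event with \<open>\<ge>\<close>, which
    contains the strict failure event.\<close>
  have "P.prob {S \<in> space ?P. \<not> Z S \<le> exp b} \<le> P.prob {S \<in> space ?P. Z S \<ge> exp b}"
  proof (rule P.finite_measure_mono)
    show "{S \<in> space ?P. Z S \<ge> exp b} \<in> sets ?P" by measurable
  qed auto
  also have "\<dots> \<le> (\<integral>S. Z S \<partial>?P) / exp b"
    using Z_int Z_pos by (intro integral_Markov_inequality_measure[where A="{}"]) (auto simp: less_imp_le)
  also have "\<dots> \<le> exp (t\<^sup>2 / (2 * (real n - 1))) / exp b"
    using EZ by (intro divide_right_mono) auto
  \<comment> \<open>\<open>exp b\<close> is the moment bound times
    \<open>(n + 1) / \<epsilon>\<close>, so the moment bound cancels.\<close>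
  also have "\<dots> = \<epsilon> / (real n + 1)"
    using assms(7) by (simp add: b_def exp_add)
  also have "\<dots> \<le> \<epsilon>"
    using assms(7) by (simp add: field_simps)
  finally have "P.prob {S \<in> space ?P. \<not> Z S \<le> exp b} \<le> \<epsilon>" .
  moreover have "{S \<in> space ?P. Z S \<le> exp b} \<in> P.events" by measurable
  ultimately show ?thesis
    unfolding good_iff by (simp only: P.prob_neg)
qed

end
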